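(* Let $\sigma>1$ and $\rho_\sigma=e^{-1/\sigma}$, and let $$f_{\rho_\sigma,\sigma}(x)=\exp\left\{-\rho_\sigma\,W^{-\frac1{\sigma-1}}\Big(\ln\Big(1+\frac1{|x|}\Big)\Big)\,\ln^{\frac{\sigma}{\sigma-1}}\Big(1+\frac1{|x|}\Big)\right\}\quad (x\in\mathbb R\setminus\{0\}),\qquad f_{\rho_\sigma,\sigma}(0)=0.$$ Then $f_{\rho_\sigma,\sigma}\in\mathcal E_\sigma(\mathbb R)$.
   Context: $W$ is the principal branch of the Lambert function (the inverse of $z\mapsto ze^z$). Extended Gevrey classes: for $\tau>0$, $\sigma>1$ let $M_0^{\tau,\sigma}=1$ and $M_p^{\tau,\sigma}=p^{\tau p^{\sigma}}$ for $p\in\mathbb N=\{1,2,\dots\}$. A smooth function $\phi$ on $\mathbb R$ belongs to $\mathcal E_{\tau,\sigma}(\mathbb R)$ if for every compact $\mathbb K\subset\mathbb R$ there is $C>0$ such that $\sup_{x\in\mathbb K}|\phi^{(p)}(x)|\le C^{p^{\sigma}+1}M_p^{\tau,\sigma}$ for all $p\in\mathbb N_0$. Set $\mathcal E_\sigma(\mathbb R)=\bigcup_{\tau>0}\mathcal E_{\tau,\sigma}(\mathbb R)$. *)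

theory Defs
  imports "HOL-Analysis.Analysis"
begin

text \<open>The principal branch of the Lambert function on its real domain \<open>[-1/e, \<infinity>)\<close>: the inverse of
  \<open>w \<mapsto> w e\<^sup>w\<close> restricted to \<open>w \<ge> -1\<close>. Values outside \<open>[-1/e, \<infinity>)\<close> are meaningless.\<close>

definition lambert_W :: "real \<Rightarrow> real" where
  "lambert_W = inv_into {-1..} (\<lambda>w. w * exp w)"

lemma bij_betw_times_exp: "bij_betw (\<lambda>w::real. w * exp w) {-1..} {- exp (-1)..}"
proof -
  let ?g = "\<lambda>w::real. w * exp w"
  have deriv: "(?g has_real_derivative (1 + x) * exp x) (at x)" for x
    by (auto intro!: derivative_eq_intros simp: algebra_simps)
  have cont: "continuous_on S ?g" for S
    by (intro continuous_intros)
  have less: "?g x < ?g y" if "-1 \<le> x" "x < y" for x y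
  proof (rule DERIV_pos_imp_increasing_open[OF that(2)])
    fix z assume "x < z" "z < y"
    with that show "\<exists>D. (?g has_real_derivative D) (at z) \<and> D > 0"
      by (intro exI[of _ "(1 + z) * exp z"] conjI deriv) auto
  qed (rule cont)
  have inj: "inj_on ?g {-1..}"
    by (rule linorder_inj_onI) (use less in force)+
  have "y \<in> ?g ` {-1..}" if "y \<ge> - exp (-1)" for y
  proof -
    have "\<bar>y\<bar> * 1 \<le> \<bar>y\<bar> * exp \<bar>y\<bar>"
      by (intro mult_left_mono) auto
    then have "y \<le> ?g \<bar>y\<bar>"
      by simp
    with that have "\<exists>x\<ge>-1. x \<le> \<bar>y\<bar> \<and> ?g x = y"
      by (intro IVT' cont) auto
    then show ?thesis
      by force
  qed
  moreover have "?g x \<ge> - exp (-1)" if "x \<ge> -1" for x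
    using less[of "-1" x] that by (cases "x = -1") auto
  ultimately show ?thesis
    using inj by (auto simp: bij_betw_def)
qed

lemma lambert_W:
  assumes "x \<ge> - exp (-1)"
  shows "lambert_W x \<ge> -1" and "lambert_W x * exp (lambert_W x) = x"
proof -
  have "x \<in> (\<lambda>w. w * exp w) ` {-1..}"
    using bij_betw_imp_surj_on[OF bij_betw_times_exp] assms by simp
  from inv_into_into[OF this] f_inv_into_f[OF this]
  show "lambert_W x \<ge> -1" "lambert_W x * exp (lambert_W x) = x"
    unfolding lambert_W_def by auto
qed

definition smooth_real :: "(real \<Rightarrow> real) \<Rightarrow> bool" where
  "smooth_real \<phi> \<longleftrightarrow> (\<forall>p x. (deriv ^^ p) \<phi> field_differentiable at x)"

definition gevrey_weight :: "real \<Rightarrow> real \<Rightarrow> nat \<Rightarrow> real" where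
  "gevrey_weight \<tau> \<sigma> p = (if p = 0 then 1 else real p powr (\<tau> * real p powr \<sigma>))"

definition extended_gevrey2 :: "real \<Rightarrow> real \<Rightarrow> (real \<Rightarrow> real) set" where
  "extended_gevrey2 \<tau> \<sigma> = {\<phi>. smooth_real \<phi> \<and>
     (\<forall>K. compact K \<longrightarrow> (\<exists>C>0. \<forall>p. \<forall>x\<in>K.
        \<bar>(deriv ^^ p) \<phi> x\<bar> \<le> C powr (real p powr \<sigma> + 1) * gevrey_weight \<tau> \<sigma> p))}"

definition extended_gevrey :: "real \<Rightarrow> (real \<Rightarrow> real) set" where
  "extended_gevrey \<sigma> = (\<Union>\<tau>\<in>{0<..}. extended_gevrey2 \<tau> \<sigma>)"

definition lambert_flat :: "real \<Rightarrow> real \<Rightarrow> real \<Rightarrow> real" where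
  "lambert_flat \<rho> \<sigma> x =
     (if x = 0 then 0
      else exp (- (\<rho> * lambert_W (ln (1 + 1 / \<bar>x\<bar>)) powr (- (1 / (\<sigma> - 1)))
                     * ln (1 + 1 / \<bar>x\<bar>) powr (\<sigma> / (\<sigma> - 1)))))"

end

theory Submission
  imports Defs "HOL-Complex_Analysis.Complex_Analysis"
begin

text \<open>
  With \<open>L = ln (1 + 1/\<bar>x\<bar>)\<close> and \<open>a = 1/(\<sigma> - 1)\<close>, the relation \<open>W(L) e\<^bsup>W(L)\<^esup> = L\<close> turns the function
  into \<open>exp (- \<rho> L e\<^bsup>a W(L)\<^esup>)\<close>. On a strip around the positive axis the derivative of \<open>w e\<^sup>w\<close> has real
  part at least 1/2, so \<open>W\<close> continues holomorphically to discs of uniform radius around \<open>[l\<^sub>0, \<infinity>)\<close>. Hence on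
  \<open>0 < \<bar>x\<bar> \<le> R\<close> the function continues to discs of radius \<open>c \<bar>x\<bar>\<close>, bounded there by
  \<open>exp (- \<rho> L e\<^bsup>a W(L)\<^esup> / 2)\<close>. As \<open>1/\<bar>x\<bar> \<le> e\<^sup>L\<close>, Cauchy's estimate bounds the \<open>p\<close>-th derivative by
  \<open>p! D\<^sup>p exp (p L - \<rho> L e\<^bsup>a W(L)\<^esup> / 2)\<close>. Maximising over \<open>L\<close> gives a bound \<open>C\<^sup>P p\<^bsup>\<tau> P\<^esup>\<close> with \<open>P = p\<^bsup>\<sigma>\<^esup>\<close>; the
  same maximisation with \<open>p + 2\<close> in place of \<open>p\<close> gives \<open>O(x\<^sup>2)\<close>, whence all derivatives vanish at 0.
\<close>

section \<open>The real Lambert function and a product form of the flat function\<close>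

lemma lambert_W_pos:
  assumes "x > 0"
  shows "lambert_W x > 0"
proof -
  have "x \<ge> - exp (-1)"
    using assms exp_ge_zero[of "-1"] by linarith
  from lambert_W(2)[OF this] show ?thesis
    using assms by (metis exp_gt_zero mult_pos_pos zero_less_mult_pos2)
qed

lemma lambert_W_times_exp:
  assumes "x > 0"
  shows "lambert_W x * exp (lambert_W x) = x"
proof (rule lambert_W(2))
  show "- exp (-1) \<le> x"
    using assms exp_ge_zero[of "-1"] by linarith
qed

lemma lambert_W_mono:
  assumes "0 < x" "x \<le> y"
  shows "lambert_W x \<le> lambert_W y"
proof (rule ccontr)
  assume "\<not> ?thesis"
  then have "lambert_W y * exp (lambert_W y) < lambert_W x * exp (lambert_W x)"
    using lambert_W_pos assms by (intro mult_strict_mono) auto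
  then show False
    using lambert_W_times_exp[of x] lambert_W_times_exp[of y] assms by simp
qed

text \<open>Raising \<open>w * exp w = l\<close> to the power \<open>a = 1 / (\<sigma> - 1)\<close>
  produces a factor \<open>w powr a\<close> that cancels the negative power of \<open>W\<close>, and
  \<open>\<sigma> / (\<sigma> - 1) = a + 1\<close> leaves one factor \<open>l\<close>. The resulting
  form is the one that is continued to complex arguments.\<close>

lemma lambert_flat_eq:
  assumes "\<sigma> > 1" "x \<noteq> 0"
  defines "l \<equiv> ln (1 + 1 / \<bar>x\<bar>)"
  shows "lambert_flat \<rho> \<sigma> x = exp (- (\<rho> * (l * exp (1 / (\<sigma> - 1) * lambert_W l))))"
proof -
  define a where "a = 1 / (\<sigma> - 1)"
  define w where "w = lambert_W l"
  have l: "l > 0"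
    unfolding l_def using assms(2) by (intro ln_gt_zero) simp
  have w: "w > 0" "w * exp w = l"
    using lambert_W_pos[OF l] lambert_W_times_exp[OF l] by (auto simp: w_def)
  have "\<sigma> / (\<sigma> - 1) = a + 1"
    using assms by (simp add: a_def field_simps)
  then have "l powr (\<sigma> / (\<sigma> - 1)) = l powr a * l"
    using l by (simp add: powr_add)
  also have "l powr a = w powr a * exp (a * w)"
    using w(1) by (subst w(2)[symmetric]) (simp add: powr_mult exp_powr_real mult.commute)
  finally have "w powr (- a) * l powr (\<sigma> / (\<sigma> - 1)) = (w powr (-a) * w powr a) * (l * exp (a * w))"
    by (simp only: mult_ac)
  also have "w powr (-a) * w powr a = 1"
    using w(1) by (simp flip: powr_add)
  finally show ?thesis
    using assms(2) by (simp add: lambert_flat_def a_def w_def l_def mult.assoc)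
qed

section \<open>From complex to real derivatives\<close>

text \<open>Along the real axis the complex derivative of \<open>F\<close> is the vector derivative
  of \<open>t \<mapsto> F t\<close>; uniqueness of vector derivatives carries the agreement from
  order \<open>p\<close> to order \<open>p + 1\<close>. This makes Cauchy's estimate available for
  real derivatives.\<close>

lemma higher_deriv_of_holomorphic_extension:
  fixes f :: "real \<Rightarrow> real"
  assumes F: "F holomorphic_on S" "open S"
    and eq: "\<And>t. of_real t \<in> S \<Longrightarrow> F (of_real t) = of_real (f t)"
    and t: "of_real t \<in> S"
  shows "(deriv ^^ p) F (of_real t) = of_real ((deriv ^^ p) f t)"
    and "(deriv ^^ p) f field_differentiable at t"
proof -
  define T where "T = complex_of_real -` S"
  have T: "open T"
    unfolding T_def by (intro continuous_open_vimage F) auto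
  \<comment> \<open>Agreement at order \<open>p\<close> alone already makes the real derivative of
    order \<open>p\<close> differentiable, by taking real parts. The induction in
    \<open>main\<close> needs this before \<open>deriv\<close> of it has a meaning.\<close>
  have diff: "((deriv ^^ p) f has_field_derivative Re ((deriv ^^ Suc p) F (of_real t))) (at t)"
    if eq: "\<And>t. t \<in> T \<Longrightarrow> (deriv ^^ p) F (of_real t) = of_real ((deriv ^^ p) f t)" and t: "t \<in> T" for p t
  proof -
    have "((deriv ^^ p) F has_field_derivative (deriv ^^ Suc p) F (of_real t)) (at (of_real t))"
      using has_field_derivative_higher_deriv[OF F] t by (auto simp: T_def)
    from has_field_derivative_Re[OF has_vector_derivative_real_field[OF this]]
    have "((\<lambda>t. Re ((deriv ^^ p) F (of_real t))) has_field_derivative Re ((deriv ^^ Suc p) F (of_real t))) (at t)"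
      by simp
    then show ?thesis
      by (rule has_field_derivative_transform_within_open[OF _ T t]) (simp add: eq)
  qed
  have main: "(deriv ^^ p) F (of_real t) = of_real ((deriv ^^ p) f t)" if "t \<in> T" for p t
    using that
  proof (induction p arbitrary: t)
    case 0
    then show ?case using eq by (simp add: T_def)
  next
    case (Suc p)
    have "((deriv ^^ p) F has_field_derivative (deriv ^^ Suc p) F (of_real t)) (at (of_real t))"
      using has_field_derivative_higher_deriv[OF F] Suc.prems by (auto simp: T_def)
    then have 1: "((\<lambda>t. (deriv ^^ p) F (of_real t)) has_vector_derivative (deriv ^^ Suc p) F (of_real t)) (at t)"
      by (rule has_vector_derivative_real_field)
    have 2: "((deriv ^^ p) f has_field_derivative deriv ((deriv ^^ p) f) t) (at t)"
      using diff[OF Suc.IH Suc.prems] DERIV_imp_deriv by metis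
    have "((\<lambda>t. complex_of_real ((deriv ^^ p) f t)) has_vector_derivative of_real (deriv ((deriv ^^ p) f) t)) (at t)"
      using 2 by (intro has_vector_derivative_of_real) (simp add: has_real_derivative_iff_has_vector_derivative)
    then have "((\<lambda>t. (deriv ^^ p) F (of_real t)) has_vector_derivative of_real (deriv ((deriv ^^ p) f) t)) (at t)"
      by (rule has_vector_derivative_transform_within_open[OF _ T Suc.prems]) (simp add: Suc.IH)
    from vector_derivative_unique_at[OF 1 this] show ?case
      by simp
  qed
  show "(deriv ^^ p) F (of_real t) = of_real ((deriv ^^ p) f t)"
    using main t by (simp add: T_def)
  show "(deriv ^^ p) f field_differentiable at t"
    using diff[OF main, of t p] t unfolding field_differentiable_def by (auto simp: T_def)
qed

section \<open>Holomorphic continuation of \<open>W\<close>\<close>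

text \<open>A convex neighbourhood of the values of \<open>W\<close> on the positive axis, narrow
  enough for the derivative of \<open>w * exp w\<close> to have real part bounded below.\<close>

definition lambert_strip :: "complex set" where
  "lambert_strip = {w. Re w > 0 \<and> \<bar>Im w\<bar> < 1/2}"

lemma open_lambert_strip: "open lambert_strip"
  unfolding lambert_strip_def
  by (intro open_Collect_conj open_Collect_less continuous_intros)

lemma convex_lambert_strip: "convex lambert_strip"
proof -
  have eq: "lambert_strip = {w. Re w > 0} \<inter> {w. Im w < 1/2} \<inter> {w. Im w > - (1/2)}"
    by (auto simp: lambert_strip_def)
  show ?thesis
    unfolding eq by (intro convex_Int convex_halfspace_Re_gt convex_halfspace_Im_gt convex_halfspace_Im_lt)
qed

text \<open>For \<open>w = x + iy\<close> the real part is
  \<open>exp x * ((1 + x) * cos y - y * sin y)\<close>. From \<open>\<bar>y\<bar> < 1/2\<close>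
  follow \<open>cos y \<ge> 7/8\<close> and \<open>y * sin y \<le> 1/4\<close>, so the bracket is at
  least 5/8.\<close>

lemma Re_deriv_times_exp_ge:
  assumes "w \<in> lambert_strip"
  shows "Re ((1 + w) * exp w) \<ge> 1/2"
proof -
  define x y where "x = Re w" and "y = Im w"
  have xy: "x > 0" "\<bar>y\<bar> < 1/2"
    using assms by (auto simp: lambert_strip_def x_def y_def)
  have sq: "y * y \<le> 1/4"
    using mult_mono[of "\<bar>y\<bar>" "1/2" "\<bar>y\<bar>" "1/2"] xy by simp
  have "cos y = 1 - 2 * (sin (y / 2))\<^sup>2"
    using cos_double_sin[of "y/2"] by simp
  moreover have "(sin (y/2))\<^sup>2 \<le> (y/2)\<^sup>2"
    using abs_sin_x_le_abs_x[of "y/2"] by (simp only: abs_le_square_iff)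
  ultimately have cos: "cos y \<ge> 7/8"
    using sq by (simp add: power2_eq_square)
  have "y * sin y \<le> \<bar>y\<bar> * \<bar>sin y\<bar>"
    by (metis abs_ge_self abs_mult)
  also have "\<dots> \<le> \<bar>y\<bar> * \<bar>y\<bar>"
    by (intro mult_left_mono abs_sin_x_le_abs_x) auto
  finally have sin: "y * sin y \<le> 1/4"
    using sq by simp
  have "1 * (1/2) \<le> exp x * ((1 + x) * cos y - y * sin y)"
  proof (intro mult_mono)
    have "1 * cos y \<le> (1 + x) * cos y"
      using xy cos by (intro mult_right_mono) auto
    then show "1/2 \<le> (1 + x) * cos y - y * sin y"
      using cos sin by linarith
  qed (use xy in auto)
  also have "\<dots> = Re ((1 + w) * exp w)"
    by (simp add: Re_exp Im_exp x_def y_def algebra_simps)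
  finally show ?thesis by simp
qed

text \<open>Mean value theorem along the segment from \<open>v\<close> to \<open>w\<close>, which
  stays in the strip by convexity. It yields both injectivity and a quantitative inverse.\<close>

lemma times_exp_expansive:
  assumes "v \<in> lambert_strip" "w \<in> lambert_strip"
  shows "norm (w * exp w - v * exp v) \<ge> norm (w - v) / 2"
proof (cases "w = v")
  case False
  \<comment> \<open>The complex mean value theorem controls only the real part of derivative times
    increment; dividing by \<open>w - v\<close> beforehand reduces that to
    \<open>Re ((1 + u) * exp u)\<close>.\<close>
  have "((\<lambda>z. z * exp z / (w - v)) has_field_derivative (1 + u) * exp u / (w - v)) (at u)" for u
    by (rule DERIV_cdivide) (auto intro!: derivative_eq_intros simp: algebra_simps)
  from complex_mvt_line[of v w, OF this]
  obtain u where u: "u \<in> closed_segment v w"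
    "Re (w * exp w / (w - v)) - Re (v * exp v / (w - v)) = Re ((1 + u) * exp u)"
    using False by auto
  have "u \<in> lambert_strip"
    using u(1) closed_segment_subset[OF assms convex_lambert_strip] by blast
  then have "1/2 \<le> Re ((w * exp w - v * exp v) / (w - v))"
    using Re_deriv_times_exp_ge[of u] u(2) by (simp add: diff_divide_distrib)
  also have "\<dots> \<le> norm ((w * exp w - v * exp v) / (w - v))"
    by (rule complex_Re_le_cmod)
  finally show ?thesis
    using False by (simp add: norm_divide field_simps)
qed simp

lemma cball_subset_lambert_strip:
  assumes "s < w" "s < 1/2"
  shows "cball (of_real w) s \<subseteq> lambert_strip"
proof
  fix z assume "z \<in> cball (complex_of_real w) s"
  then have "norm (z - of_real w) \<le> s"
    by (simp add: dist_norm norm_minus_commute)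
  then have "\<bar>Re z - w\<bar> \<le> s" "\<bar>Im z\<bar> \<le> s"
    using abs_Re_le_cmod[of "z - of_real w"] abs_Im_le_cmod[of "z - of_real w"] by auto
  then show "z \<in> lambert_strip"
    using assms by (auto simp: lambert_strip_def)
qed

text \<open>\<open>H\<close> is the inverse of the injective map \<open>w * exp w\<close> on the
  strip. The last clause is a uniform inverse function theorem: the radius \<open>s/2\<close>
  depends on \<open>l\<close> only through \<open>s < lambert_W l\<close>.\<close>

lemma complex_lambert_W:
  obtains H where "H holomorphic_on ((\<lambda>w. w * exp w) ` lambert_strip)"
    and "\<And>l. l > 0 \<Longrightarrow> H (of_real l) = of_real (lambert_W l)"
    and "\<And>l s. \<lbrakk>l > 0; 0 < s; s < lambert_W l; s < 1/2\<rbrakk> \<Longrightarrow>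
           ball (of_real l) (s/2) \<subseteq> (\<lambda>w. w * exp w) ` lambert_strip
           \<and> H ` ball (of_real l) (s/2) \<subseteq> ball (of_real (lambert_W l)) s"
proof -
  let ?g = "\<lambda>w::complex. w * exp w"
  have inj: "inj_on ?g lambert_strip"
  proof (rule inj_onI)
    fix v w assume "v \<in> lambert_strip" "w \<in> lambert_strip" "?g v = ?g w"
    then show "v = w"
      using times_exp_expansive[of v w] by simp
  qed
  have hol: "?g holomorphic_on A" for A
    by (intro holomorphic_intros)
  obtain H where H: "H holomorphic_on (?g ` lambert_strip)" "\<And>w. w \<in> lambert_strip \<Longrightarrow> H (?g w) = w"
    using holomorphic_has_inverse[OF hol open_lambert_strip inj] by metis
  have g: "?g (of_real (lambert_W l)) = of_real l" if "l > 0" for l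
    using lambert_W_times_exp[OF that] by (metis exp_of_real of_real_mult)
  show thesis
  proof (rule that[OF H(1)])
    fix l :: real assume l: "l > 0"
    show "H (of_real l) = of_real (lambert_W l)"
      using H(2)[of "of_real (lambert_W l)"] lambert_W_pos[OF l] g[OF l] by (simp add: lambert_strip_def)
    fix s :: real assume s: "0 < s" "s < lambert_W l" "s < 1/2"
    let ?B = "ball (complex_of_real (lambert_W l)) s"
    have sub: "cball (of_real (lambert_W l)) s \<subseteq> lambert_strip"
      by (rule cball_subset_lambert_strip) (use s in auto)
    then have subB: "?B \<subseteq> lambert_strip" by auto
    \<comment> \<open>By expansiveness the circle of radius \<open>s\<close> about
      \<open>W(l)\<close> is sent to points at distance at least \<open>s/2\<close> from
      \<open>l\<close>, so the open image of the disc contains the disc of radius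
      \<open>s/2\<close>.\<close>
    have "ball (?g (of_real (lambert_W l))) (s/2) \<subseteq> ?g ` ?B"
    proof (rule ball_subset_open_map_image)
      show "continuous_on (closure ?B) ?g"
        by (intro continuous_intros)
      have "open (?g ` ?B)"
        by (rule open_mapping_thm3[OF hol]) (use inj_on_subset[OF inj subB] in auto)
      then show "open (?g ` interior ?B)"
        by simp
      fix z assume "z \<in> frontier ?B"
      then have z: "norm (z - of_real (lambert_W l)) = s"
        using s by (simp add: dist_norm norm_minus_commute)
      then have "z \<in> cball (of_real (lambert_W l)) s"
        by (simp add: dist_norm norm_minus_commute)
      moreover have "of_real (lambert_W l) \<in> lambert_strip"
        using sub s by auto
      ultimately show "s/2 \<le> norm (?g z - ?g (of_real (lambert_W l)))"
        using times_exp_expansive[of "of_real (lambert_W l)" z] sub z by auto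
    qed (use s in auto)
    then have "ball (of_real l) (s/2) \<subseteq> ?g ` ?B"
      by (simp only: g[OF l])
    then show "ball (of_real l) (s/2) \<subseteq> ?g ` lambert_strip \<and> H ` ball (of_real l) (s/2) \<subseteq> ?B"
      using subB H(2) by fastforce
  qed
qed

section \<open>Holomorphic continuation of the flat function\<close>

lemma ln_add_one_minus_ln:
  fixes x :: real
  assumes "x > 0"
  shows "ln (1 + x) - ln x = ln (1 + 1 / x)"
proof -
  have "1 + 1 / x = (1 + x) / x"
    using assms by (simp add: field_simps)
  then show ?thesis
    using assms by (simp add: ln_div)
qed

text \<open>The derivative of \<open>Ln (1 + z) - Ln z\<close> is
  \<open>- 1 / (z * (1 + z))\<close>, of modulus at most \<open>2 / x\<close> on the disc. A radius
  proportional to \<open>x\<close> thus gives an error independent of \<open>x\<close>.\<close>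

lemma norm_Ln_quotient_diff_le:
  assumes "x > 0" "0 < c" "c \<le> 1/2" "z \<in> ball (complex_of_real x) (c * x)"
  shows "norm ((Ln (1 + z) - Ln z) - of_real (ln (1 + 1 / x))) < 2 * c"
proof -
  let ?B = "ball (complex_of_real x) (c * x)"
  have cx: "c * x \<le> x / 2"
    using assms by simp
  have B: "norm u \<ge> x / 2 \<and> Re u > 0" if "u \<in> ?B" for u
  proof -
    have u: "norm (u - of_real x) < x / 2"
      using that cx by (simp add: dist_norm norm_minus_commute)
    then have "Re u \<ge> x / 2"
      using abs_Re_le_cmod[of "u - of_real x"] by (simp add: abs_if split: if_splits)
    then show ?thesis
      using complex_Re_le_cmod[of u] \<open>x > 0\<close> by linarith
  qed
  have "norm ((Ln (1 + z) - Ln z) - (Ln (1 + of_real x) - Ln (of_real x))) \<le> (2 / x) * norm (z - of_real x)"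
  proof (rule field_differentiable_bound[of ?B _ "\<lambda>u. 1 / (1 + u) - 1 / u"])
    fix u assume u: "u \<in> ?B"
    then have nz: "Re u > 0" "u \<noteq> 0" "1 + u \<noteq> 0" "u \<notin> \<real>\<^sub>\<le>\<^sub>0" "1 + u \<notin> \<real>\<^sub>\<le>\<^sub>0"
      using B[OF u] by (auto simp: complex_nonpos_Reals_iff complex_eq_iff)
    show "((\<lambda>z. Ln (1 + z) - Ln z) has_field_derivative 1 / (1 + u) - 1 / u) (at u within ?B)"
      using nz by (auto intro!: derivative_eq_intros simp: field_simps)
    have "1 \<le> norm (1 + u)"
      using complex_Re_le_cmod[of "1 + u"] nz by simp
    then have "x / 2 * 1 \<le> norm u * norm (1 + u)"
      using B[OF u] \<open>x > 0\<close> by (intro mult_mono) auto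
    then have "1 / (norm u * norm (1 + u)) \<le> 1 / (x / 2)"
      using \<open>x > 0\<close> by (intro divide_left_mono) auto
    moreover have "1 / (1 + u) - 1 / u = - 1 / (u * (1 + u))"
      using nz by (simp add: field_simps)
    ultimately show "norm (1 / (1 + u) - 1 / u) \<le> 2 / x"
      by (simp add: norm_divide norm_mult)
  qed (use assms in auto)
  also have "\<dots> < (2 / x) * (c * x)"
    using assms by (intro mult_strict_left_mono) (auto simp: dist_norm norm_minus_commute)
  also have "\<dots> = 2 * c"
    using assms by simp
  also have "Ln (1 + of_real x) - Ln (of_real x) = of_real (ln (1 + x) - ln x)"
    using assms Ln_of_real[of x] Ln_of_real[of "1 + x"] by simp
  also have "ln (1 + x) - ln x = ln (1 + 1 / x)"
    using assms(1) by (rule ln_add_one_minus_ln)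
  finally show ?thesis .
qed

text \<open>Relative to \<open>l * E\<close>, the two perturbations cost at most
  \<open>1/4 + (1/8) * (5/4) = 13/32\<close>, less than one half. It is applied with
  \<open>E = exp (a * W(l))\<close>.\<close>

lemma Re_perturbed_product_ge:
  fixes \<delta> e :: complex
  assumes "l > 0" "E > 0" "norm \<delta> \<le> l / 8" "norm (e - 1) \<le> 1 / 4"
  shows "Re ((of_real l + \<delta>) * (of_real E * e)) \<ge> l * E / 2"
proof -
  have "norm (of_real l * (e - 1)) \<le> l * (1/4)"
    using assms by (simp add: norm_mult)
  moreover have "norm (\<delta> * e) \<le> (l / 8) * (5 / 4)"
    using assms norm_triangle_ineq[of "e - 1" 1] by (subst norm_mult, intro mult_mono) auto
  ultimately have "norm (of_real l * (e - 1) + \<delta> * e) \<le> l / 2"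
    using norm_triangle_ineq[of "of_real l * (e - 1)" "\<delta> * e"] assms(1) by linarith
  then have "Re (of_real l * (e - 1) + \<delta> * e) \<ge> - (l / 2)"
    using abs_Re_le_cmod[of "of_real l * (e - 1) + \<delta> * e"] by linarith
  then have "Re ((of_real l + \<delta>) * e) \<ge> l / 2"
    by (simp add: algebra_simps)
  then have "E * (l / 2) \<le> E * Re ((of_real l + \<delta>) * e)"
    using assms by (intro mult_left_mono) auto
  also have "\<dots> = Re (of_real E * ((of_real l + \<delta>) * e))"
    by simp
  also have "of_real E * ((of_real l + \<delta>) * e) = (of_real l + \<delta>) * (of_real E * e)"
    by (simp only: mult_ac)
  finally show ?thesis by (simp add: mult_ac)
qed

text \<open>The bound \<open>x \<le> R\<close> keeps \<open>l = ln (1 + 1/x)\<close> above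
  \<open>l0 > 0\<close>, and hence \<open>W(l)\<close> above \<open>W(l0) > 0\<close>, so one
  relative radius \<open>c\<close> serves all \<open>x\<close>.\<close>

lemma holomorphic_extension_pos:
  fixes a \<rho> R :: real
  assumes "a > 0" "\<rho> > 0" "R > 0"
  obtains c where "0 < c" "c \<le> 1/2"
    "\<And>x. \<lbrakk>0 < x; x \<le> R\<rbrakk> \<Longrightarrow> \<exists>F. F holomorphic_on ball (complex_of_real x) (c * x)
       \<and> (\<forall>z\<in>ball (of_real x) (c * x). norm (F z) \<le>
             exp (- (\<rho> / 2 * (ln (1 + 1 / x) * exp (a * lambert_W (ln (1 + 1 / x)))))))
       \<and> (\<forall>t. of_real t \<in> ball (complex_of_real x) (c * x) \<longrightarrow>
             F (of_real t) = of_real (exp (- (\<rho> * (ln (1 + 1 / t) * exp (a * lambert_W (ln (1 + 1 / t)))))))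
             \<and> t > 0)"
proof -
  obtain H where H: "H holomorphic_on ((\<lambda>w. w * exp w) ` lambert_strip)"
    "\<And>l. l > 0 \<Longrightarrow> H (of_real l) = of_real (lambert_W l)"
    "\<And>l s. \<lbrakk>l > 0; 0 < s; s < lambert_W l; s < 1/2\<rbrakk> \<Longrightarrow>
           ball (of_real l) (s/2) \<subseteq> (\<lambda>w. w * exp w) ` lambert_strip
           \<and> H ` ball (of_real l) (s/2) \<subseteq> ball (of_real (lambert_W l)) s"
    using complex_lambert_W by blast
  define l0 where "l0 = ln (1 + 1 / R)"
  have l0: "l0 > 0"
    unfolding l0_def using assms by (intro ln_gt_zero) simp
  have "isCont (\<lambda>z::complex. exp (of_real a * z)) 0"
    by (intro continuous_intros)
  then have "\<exists>d>0. \<forall>z. dist z 0 < d \<longrightarrow> dist (exp (complex_of_real a * z)) (exp (of_real a * 0)) < 1/4"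
    unfolding continuous_at_eps_delta by (elim allE[of _ "1/4"]) auto
  then obtain d where d: "d > 0" "\<And>z::complex. norm z < d \<Longrightarrow> norm (exp (of_real a * z) - 1) < 1/4"
    by (auto simp: dist_norm simp del: less_divide_eq_numeral1)
  \<comment> \<open>The first two entries make \<open>s\<close> admissible for the continuation of
    \<open>W\<close>; \<open>d\<close> keeps \<open>exp (a * \<eta>)\<close> within 1/4 of 1 when
    \<open>norm \<eta> < s\<close>.\<close>
  define s where "s = Min {lambert_W l0 / 2, 1/4, d}"
  have s: "s > 0" "s < lambert_W l0" "s < 1/2" "s \<le> d"
    using lambert_W_pos[OF l0] d by (auto simp: s_def min_def)
  \<comment> \<open>Since \<open>L\<close> moves by less than \<open>2 * c\<close>, the entries
    respectively keep \<open>L z\<close> in the domain of \<open>H\<close>, make the error at most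
    \<open>l / 8\<close>, and keep the disc in the right half-plane.\<close>
  define c where "c = Min {s / 4, l0 / 16, 1/2}"
  have c: "c > 0" "2 * c \<le> s / 2" "2 * c \<le> l0 / 8" "c \<le> 1/2"
    using s l0 by (auto simp: c_def min_def)
  show thesis
  proof (rule that[OF c(1,4)], intro exI conjI ballI allI impI)
    fix x :: real assume x: "0 < x" "x \<le> R"
    define l where "l = ln (1 + 1 / x)"
    define L where "L = (\<lambda>z::complex. Ln (1 + z) - Ln z)"
    define F where "F = (\<lambda>z. exp (- (of_real \<rho> * (L z * exp (of_real a * H (L z))))))"
    let ?B = "ball (complex_of_real x) (c * x)"
    have ll: "l \<ge> l0"
      unfolding l_def l0_def using x by (intro ln_mono add_left_mono divide_left_mono) (auto simp: add_pos_pos)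
    then have l: "l > 0" "s < lambert_W l"
      using l0 s lambert_W_mono[OF l0 ll] by auto
    have cx: "c * x \<le> x / 2"
      using mult_right_mono[OF c(4), of x] x(1) by simp
    have Re: "Re z > 0" if "z \<in> ?B" for z
    proof -
      have "norm (z - of_real x) < x / 2"
        using that cx by (simp add: dist_norm norm_minus_commute)
      then show ?thesis
        using abs_Re_le_cmod[of "z - of_real x"] x by (simp add: abs_if split: if_splits)
    qed
    have L: "norm (L z - of_real l) < 2 * c" if "z \<in> ?B" for z
      using norm_Ln_quotient_diff_le[OF x(1) c(1,4) that] by (simp add: L_def l_def)
    have LB: "L ` ?B \<subseteq> ball (of_real l) (s / 2)"
      using L c(2) by (force simp: dist_norm norm_minus_commute)
    note Hl = H(3)[OF l(1) s(1) l(2) s(3)]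
    have "L holomorphic_on ?B"
      unfolding L_def using Re by (intro holomorphic_intros) (force simp: complex_nonpos_Reals_iff)+
    moreover from this have "(H \<circ> L) holomorphic_on ?B"
      using LB Hl by (intro holomorphic_on_compose_gen[OF _ H(1)]) auto
    ultimately show "F holomorphic_on ?B"
      unfolding F_def by (intro holomorphic_intros) (auto simp: o_def)
    {
      fix z assume z: "z \<in> ?B"
      define \<eta> where "\<eta> = H (L z) - of_real (lambert_W l)"
      have "norm \<eta> < s"
        using Hl LB z by (force simp: \<eta>_def dist_norm norm_minus_commute)
      then have "norm (exp (of_real a * \<eta>) - 1) \<le> 1 / 4"
        using d s by (intro less_imp_le) auto
      moreover have "norm (L z - of_real l) \<le> l / 8"
        using L[OF z] c ll by linarith
      ultimately have "l * exp (a * lambert_W l) / 2 \<le>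
          Re ((of_real l + (L z - of_real l)) * (of_real (exp (a * lambert_W l)) * exp (of_real a * \<eta>)))"
        using l by (intro Re_perturbed_product_ge) auto
      also have "of_real (exp (a * lambert_W l)) * exp (of_real a * \<eta>) = exp (of_real a * H (L z))"
        by (simp add: \<eta>_def algebra_simps flip: exp_add exp_of_real)
      finally have "l * exp (a * lambert_W l) / 2 \<le> Re (L z * exp (of_real a * H (L z)))"
        by simp
      then have "\<rho> * (l * exp (a * lambert_W l) / 2) \<le> \<rho> * Re (L z * exp (of_real a * H (L z)))"
        using assms by (intro mult_left_mono) auto
      then show "norm (F z) \<le> exp (- (\<rho> / 2 * (ln (1 + 1 / x) * exp (a * lambert_W (ln (1 + 1 / x))))))"
        unfolding F_def by (simp add: l_def)
    }
    fix t assume t: "complex_of_real t \<in> ?B"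
    show "t > 0" using Re[OF t] by simp
    have "L (of_real t) = of_real (ln (1 + t) - ln t)"
      using Ln_of_real[of t] Ln_of_real[of "1 + t"] \<open>t > 0\<close> by (simp add: L_def)
    also have "ln (1 + t) - ln t = ln (1 + 1 / t)"
      using \<open>t > 0\<close> by (rule ln_add_one_minus_ln)
    finally have "L (of_real t) = of_real (ln (1 + 1 / t))" .
    moreover have "ln (1 + 1 / t) > 0"
      using \<open>t > 0\<close> by (intro ln_gt_zero) simp
    ultimately show "F (of_real t) = of_real (exp (- (\<rho> * (ln (1 + 1 / t) * exp (a * lambert_W (ln (1 + 1 / t)))))))"
      unfolding F_def by (simp add: H(2) flip: exp_of_real)
  qed
qed

section \<open>Maximisation over \<open>L\<close> and Cauchy estimates away from 0\<close>

text \<open>Outside the set where \<open>\<kappa> e\<^bsup>a W(l)\<^esup> < q\<close> the left-hand side is at most 0; on that set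
  \<open>W(l) < ln (q / \<kappa>) / a\<close>, which bounds \<open>l = W(l) e\<^bsup>W(l)\<^esup>\<close>.\<close>

lemma linear_minus_lambert_le:
  fixes \<kappa> a q l :: real
  assumes "l > 0" "a > 0" "0 < \<kappa>" "\<kappa> \<le> 1" "1 \<le> q"
  shows "q * l - \<kappa> * (l * exp (a * lambert_W l)) \<le> q * (ln (q / \<kappa>) / a * (q / \<kappa>) powr (1 / a))"
proof -
  define w where "w = lambert_W l"
  have w: "w > 0" "w * exp w = l"
    using lambert_W_pos lambert_W_times_exp assms by (auto simp: w_def)
  have qk: "q / \<kappa> \<ge> 1"
    using assms by (simp add: field_simps)
  show ?thesis
  proof (cases "\<kappa> * exp (a * w) \<ge> q")
    case True
    then have "l * (q - \<kappa> * exp (a * w)) \<le> 0"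
      using assms by (intro mult_nonneg_nonpos) auto
    moreover have "0 \<le> q * (ln (q / \<kappa>) / a * (q / \<kappa>) powr (1 / a))"
      using assms qk by (intro mult_nonneg_nonneg divide_nonneg_pos) auto
    ultimately show ?thesis
      by (simp add: w_def algebra_simps)
  next
    case False
    then have "exp (a * w) < q / \<kappa>"
      using assms by (simp add: field_simps)
    then have "a * w < ln (q / \<kappa>)"
      using qk by (metis exp_gt_zero ln_exp ln_less_cancel_iff order_less_trans)
    then have wle: "w \<le> ln (q / \<kappa>) / a"
      using assms by (simp add: field_simps)
    moreover from wle have "exp w \<le> exp (ln (q / \<kappa>) / a)"
      by simp
    moreover have "exp (ln (q / \<kappa>) / a) = (q / \<kappa>) powr (1 / a)"
      using qk assms by (simp add: powr_def)
    ultimately have "w * exp w \<le> ln (q / \<kappa>) / a * (q / \<kappa>) powr (1 / a)"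
      using w qk assms by (intro mult_mono) auto
    then have "q * l \<le> q * (ln (q / \<kappa>) / a * (q / \<kappa>) powr (1 / a))"
      using w assms by (intro mult_left_mono) auto
    moreover have "\<kappa> * (l * exp (a * lambert_W l)) \<ge> 0"
      using assms by (intro mult_nonneg_nonneg) auto
    ultimately show ?thesis
      by linarith
  qed
qed

lemma lambert_flat_higher_deriv:
  fixes \<rho> \<sigma> R :: real
  assumes "\<sigma> > 1" "\<rho> > 0" "R > 0"
  obtains D where "D \<ge> 1"
    "\<And>x p. \<lbrakk>x \<noteq> 0; \<bar>x\<bar> \<le> R\<rbrakk> \<Longrightarrow> (deriv ^^ p) (lambert_flat \<rho> \<sigma>) field_differentiable at x"
    "\<And>x p. \<lbrakk>x \<noteq> 0; \<bar>x\<bar> \<le> R\<rbrakk> \<Longrightarrow> \<bar>(deriv ^^ p) (lambert_flat \<rho> \<sigma>) x\<bar> \<le> fact p * D ^ p *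
        exp (real p * ln (1 + 1 / \<bar>x\<bar>) -
          \<rho> / 2 * (ln (1 + 1 / \<bar>x\<bar>) * exp (1 / (\<sigma> - 1) * lambert_W (ln (1 + 1 / \<bar>x\<bar>)))))"
proof -
  let ?f = "lambert_flat \<rho> \<sigma>"
  define M where "M = (\<lambda>x::real. \<rho> / 2 * (ln (1 + 1 / x) * exp (1 / (\<sigma> - 1) * lambert_W (ln (1 + 1 / x)))))"
  have "1 / (\<sigma> - 1) > 0" using assms by simp
  from holomorphic_extension_pos[OF this assms(2,3)] obtain c where c: "0 < c" "c \<le> 1/2"
    and ext: "\<And>x. \<lbrakk>0 < x; x \<le> R\<rbrakk> \<Longrightarrow> \<exists>F. F holomorphic_on ball (complex_of_real x) (c * x)
       \<and> (\<forall>z\<in>ball (of_real x) (c * x). norm (F z) \<le> exp (- M x))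
       \<and> (\<forall>t. of_real t \<in> ball (complex_of_real x) (c * x) \<longrightarrow>
             F (of_real t) = of_real (exp (- (\<rho> * (ln (1 + 1 / t) * exp (1 / (\<sigma> - 1) * lambert_W (ln (1 + 1 / t)))))))
             \<and> t > 0)"
    unfolding M_def by metis
  \<comment> \<open>The flat function is even: multiplication by \<open>sgn x\<close> carries the
    disc about \<open>x\<close> into the disc about \<open>\<bar>x\<bar>\<close>, so negative
    \<open>x\<close> reduce to positive ones.\<close>
  have ext': "\<exists>F. F holomorphic_on ball (complex_of_real x) (c * \<bar>x\<bar>)
       \<and> (\<forall>z\<in>ball (of_real x) (c * \<bar>x\<bar>). norm (F z) \<le> exp (- M \<bar>x\<bar>))
       \<and> (\<forall>t. of_real t \<in> ball (complex_of_real x) (c * \<bar>x\<bar>) \<longrightarrow> F (of_real t) = of_real (?f t))"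
    if x: "x \<noteq> 0" "\<bar>x\<bar> \<le> R" for x
  proof -
    define e :: real where "e = sgn x"
    have e: "\<bar>x\<bar> = e * x" "\<bar>e\<bar> = 1"
      using x by (auto simp: e_def abs_if sgn_if)
    obtain F where F: "F holomorphic_on ball (complex_of_real \<bar>x\<bar>) (c * \<bar>x\<bar>)"
      "\<And>z. z \<in> ball (of_real \<bar>x\<bar>) (c * \<bar>x\<bar>) \<Longrightarrow> norm (F z) \<le> exp (- M \<bar>x\<bar>)"
      "\<And>t. of_real t \<in> ball (complex_of_real \<bar>x\<bar>) (c * \<bar>x\<bar>) \<Longrightarrow>
         F (of_real t) = of_real (exp (- (\<rho> * (ln (1 + 1 / t) * exp (1 / (\<sigma> - 1) * lambert_W (ln (1 + 1 / t)))))))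
             \<and> t > 0"
      using ext[of "\<bar>x\<bar>"] x by auto
    have mem: "of_real e * z \<in> ball (complex_of_real \<bar>x\<bar>) (c * \<bar>x\<bar>)"
      if "z \<in> ball (of_real x) (c * \<bar>x\<bar>)" for z
    proof -
      have "of_real \<bar>x\<bar> - of_real e * z = of_real e * (of_real x - z)"
        by (simp add: e(1) algebra_simps)
      then have "norm (of_real \<bar>x\<bar> - of_real e * z) = norm (of_real x - z)"
        using e(2) by (simp only: norm_mult norm_of_real mult_1)
      then show ?thesis
        using that by (simp add: dist_norm)
    qed
    show ?thesis
    proof (intro exI conjI ballI allI impI)
      have "(F \<circ> (\<lambda>z. of_real e * z)) holomorphic_on ball (of_real x) (c * \<bar>x\<bar>)"
        by (rule holomorphic_on_compose_gen[OF _ F(1)]) (use mem in \<open>auto intro!: holomorphic_intros\<close>)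
      then show "(\<lambda>z. F (of_real e * z)) holomorphic_on ball (of_real x) (c * \<bar>x\<bar>)"
        by (simp add: o_def)
      show "norm (F (of_real e * z)) \<le> exp (- M \<bar>x\<bar>)" if "z \<in> ball (of_real x) (c * \<bar>x\<bar>)" for z
        using F(2) mem[OF that] by blast
      fix t assume "complex_of_real t \<in> ball (of_real x) (c * \<bar>x\<bar>)"
      from mem[OF this] have "of_real (e * t) \<in> ball (complex_of_real \<bar>x\<bar>) (c * \<bar>x\<bar>)"
        by simp
      note * = F(3)[OF this]
      then have "\<bar>t\<bar> = e * t" "t \<noteq> 0"
        using e(2) by (auto simp: abs_mult abs_if split: if_splits)
      with * show "F (of_real e * of_real t) = of_real (?f t)"
        by (simp add: lambert_flat_eq[OF assms(1)])
    qed
  qed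
  show thesis
  proof (rule that)
    show "2 / c \<ge> 1" using c by simp
    fix x :: real and p :: nat assume x: "x \<noteq> 0" "\<bar>x\<bar> \<le> R"
    let ?B = "ball (complex_of_real x) (c * \<bar>x\<bar>)"
    obtain F where F: "F holomorphic_on ?B"
      "\<And>z. z \<in> ?B \<Longrightarrow> norm (F z) \<le> exp (- M \<bar>x\<bar>)"
      "\<And>t. of_real t \<in> ?B \<Longrightarrow> F (of_real t) = of_real (?f t)"
      using ext'[OF x] by blast
    have xB: "of_real x \<in> ?B" using x c by simp
    show "(deriv ^^ p) ?f field_differentiable at x"
      by (rule higher_deriv_of_holomorphic_extension(2)[OF F(1) _ F(3) xB]) auto
    define l where "l = ln (1 + 1 / \<bar>x\<bar>)"
    \<comment> \<open>Half the radius, so that the closed disc in Cauchy's inequality lies inside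
      the open disc of holomorphy.\<close>
    define r where "r = c * \<bar>x\<bar> / 2"
    have r: "r > 0" using c x by (simp add: r_def)
    have sub: "cball (of_real x) r \<subseteq> ?B"
      using r unfolding r_def by (intro cball_subset_ball_iff[THEN iffD2]) auto
    have "norm ((deriv ^^ p) F (of_real x)) \<le> fact p * exp (- M \<bar>x\<bar>) / r ^ p"
    proof (rule Cauchy_inequality)
      show "F holomorphic_on ball (of_real x) r"
        using F(1) sub by (meson ball_subset_cball holomorphic_on_subset subset_trans)
      show "continuous_on (cball (of_real x) r) F"
        using F(1) sub by (meson holomorphic_on_imp_continuous_on holomorphic_on_subset)
      show "norm (F z) \<le> exp (- M \<bar>x\<bar>)" if "norm (of_real x - z) = r" for z
        using that sub by (intro F(2)) (auto simp: dist_norm subset_iff)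
    qed (use r in auto)
    also have "(deriv ^^ p) F (of_real x) = of_real ((deriv ^^ p) ?f x)"
      by (rule higher_deriv_of_holomorphic_extension(1)[OF F(1) _ F(3) xB]) auto
    also have "fact p * exp (- M \<bar>x\<bar>) / r ^ p = fact p * (exp (- M \<bar>x\<bar>) * (1 / r) ^ p)"
      by (simp add: power_one_over field_simps)
    also have "\<dots> \<le> fact p * (exp (- M \<bar>x\<bar>) * ((2 / c) * exp l) ^ p)"
    proof (intro mult_left_mono power_mono)
      have "exp l = 1 + 1 / \<bar>x\<bar>"
        using x by (simp add: l_def add_pos_pos)
      moreover have "1 / r = (2 / c) * (1 / \<bar>x\<bar>)"
        by (simp add: r_def)
      ultimately show "1 / r \<le> (2 / c) * exp l"
        using c by (simp only:) (intro mult_left_mono, auto)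
    qed (use r in auto)
    also have "\<dots> = fact p * (2 / c) ^ p * exp (real p * l - M \<bar>x\<bar>)"
    proof -
      have "exp (real p * l - M \<bar>x\<bar>) = exp l ^ p * exp (- M \<bar>x\<bar>)"
        by (simp add: exp_diff exp_minus exp_of_nat_mult divide_inverse)
      then show ?thesis
        by (simp only: power_mult_distrib mult_ac)
    qed
    finally show "\<bar>(deriv ^^ p) ?f x\<bar> \<le> fact p * (2 / c) ^ p *
        exp (real p * ln (1 + 1 / \<bar>x\<bar>) -
          \<rho> / 2 * (ln (1 + 1 / \<bar>x\<bar>) * exp (1 / (\<sigma> - 1) * lambert_W (ln (1 + 1 / \<bar>x\<bar>)))))"
      by (simp add: l_def M_def)
  qed
qed

section \<open>Flatness at 0\<close>

lemma DERIV_0_of_quadratic_bound: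
  fixes g :: "real \<Rightarrow> real"
  assumes "g 0 = 0" and bound: "\<And>x. x \<noteq> 0 \<Longrightarrow> \<bar>x\<bar> \<le> 1 \<Longrightarrow> \<bar>g x\<bar> \<le> B * x\<^sup>2"
  shows "(g has_field_derivative 0) (at 0)"
proof -
  have "((\<lambda>x. g x / x) \<longlongrightarrow> 0) (at 0)"
  proof (rule Lim_null_comparison)
    show "((\<lambda>x. B * \<bar>x\<bar>) \<longlongrightarrow> 0) (at 0)"
      by (auto intro!: tendsto_eq_intros)
    have "eventually (\<lambda>x::real. x \<in> {-1<..<1}) (at 0)"
      by (intro eventually_at_in_open') auto
    moreover have "eventually (\<lambda>x::real. x \<noteq> 0) (at 0)"
      by (simp add: eventually_at_filter)
    ultimately show "eventually (\<lambda>x. norm (g x / x) \<le> B * \<bar>x\<bar>) (at 0)"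
    proof eventually_elim
      case (elim x)
      then have "\<bar>g x\<bar> \<le> B * x\<^sup>2"
        by (intro bound) auto
      then have "\<bar>g x\<bar> \<le> B * \<bar>x\<bar> * \<bar>x\<bar>"
        by (simp add: power2_eq_square mult.assoc)
      with elim show ?case by (simp add: field_simps)
    qed
  qed
  then show ?thesis
    using assms(1) by (simp add: has_field_derivative_iff)
qed

text \<open>If the derivative of order \<open>p\<close> vanishes at 0 and is
  \<open>O(x\<^sup>2)\<close> nearby, it has derivative 0 there, so the next order vanishes
  too.\<close>

lemma lambert_flat_higher_deriv_0:
  assumes "\<sigma> > 1" "0 < \<rho>" "\<rho> \<le> 1"
  shows "(deriv ^^ p) (lambert_flat \<rho> \<sigma>) 0 = 0"
    and "(deriv ^^ p) (lambert_flat \<rho> \<sigma>) field_differentiable at 0"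
proof -
  let ?f = "lambert_flat \<rho> \<sigma>"
  obtain D where D: "D \<ge> 1"
    "\<And>x p. \<lbrakk>x \<noteq> 0; \<bar>x\<bar> \<le> 1\<rbrakk> \<Longrightarrow> \<bar>(deriv ^^ p) ?f x\<bar> \<le> fact p * D ^ p *
        exp (real p * ln (1 + 1 / \<bar>x\<bar>) -
          \<rho> / 2 * (ln (1 + 1 / \<bar>x\<bar>) * exp (1 / (\<sigma> - 1) * lambert_W (ln (1 + 1 / \<bar>x\<bar>)))))"
    using lambert_flat_higher_deriv[OF assms(1,2) zero_less_one] by metis
  have D0: "((deriv ^^ p) ?f has_field_derivative 0) (at 0)" if "(deriv ^^ p) ?f 0 = 0" for p
  proof (rule DERIV_0_of_quadratic_bound[of "(deriv ^^ p) ?f", OF that])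
    define a where "a = 1 / (\<sigma> - 1)"
    have a: "a > 0" using assms by (simp add: a_def)
    \<comment> \<open>The two spare units leave a factor \<open>exp (- 2 * l)\<close>, and
      \<open>exp (- l) \<le> \<bar>x\<bar>\<close> turns it into the quadratic bound.\<close>
    define q where "q = real p + 2"
    define S where "S = q * (ln (q / (\<rho> / 2)) / a * (q / (\<rho> / 2)) powr (1 / a))"
    fix x :: real assume x: "x \<noteq> 0" "\<bar>x\<bar> \<le> 1"
    define l where "l = ln (1 + 1 / \<bar>x\<bar>)"
    have l: "l > 0"
      unfolding l_def using x by (intro ln_gt_zero) simp
    define E where "E = \<rho> / 2 * (l * exp (a * lambert_W l))"
    have "q * l - E \<le> S"
      unfolding E_def S_def by (rule linear_minus_lambert_le) (use l a assms in \<open>auto simp: q_def\<close>)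
    then have "exp (real p * l - E) \<le> exp (S - 2 * l)"
      by (simp add: q_def algebra_simps)
    also have "\<dots> = exp S * (exp (- l))\<^sup>2"
      by (simp add: exp_diff exp_minus field_simps power2_eq_square flip: exp_add)
    also have "\<dots> \<le> exp S * \<bar>x\<bar>\<^sup>2"
    proof (intro mult_left_mono power_mono)
      have "exp l = 1 + 1 / \<bar>x\<bar>"
        using x by (simp add: l_def add_pos_pos)
      then have "exp (- l) = \<bar>x\<bar> / (\<bar>x\<bar> + 1)"
        using x by (simp add: exp_minus field_simps)
      also have "\<dots> \<le> \<bar>x\<bar> / 1"
        using x by (intro divide_left_mono) auto
      finally show "exp (- l) \<le> \<bar>x\<bar>" by simp
    qed auto
    finally have "fact p * D ^ p * exp (real p * l - E) \<le> fact p * D ^ p * (exp S * \<bar>x\<bar>\<^sup>2)"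
      using D(1) by (intro mult_left_mono) auto
    from order_trans[OF D(2)[OF x, of p, folded l_def a_def, folded E_def] this]
    show "\<bar>(deriv ^^ p) ?f x\<bar> \<le> (fact p * D ^ p * exp S) * x\<^sup>2"
      by (simp add: mult.assoc)
  qed
  show 0: "(deriv ^^ p) ?f 0 = 0" for p
  proof (induction p)
    case 0
    show ?case by (simp add: lambert_flat_def)
  next
    case (Suc p)
    then show ?case using DERIV_imp_deriv[OF D0[OF Suc]] by simp
  qed
  show "(deriv ^^ p) ?f field_differentiable at 0"
    using D0[OF 0] field_differentiable_def by blast
qed

section \<open>Gevrey bounds and conclusion\<close>

text \<open>With \<open>P = p powr \<sigma>\<close> the exponent equals
  \<open>A * P * ln (p / \<kappa>)\<close>, which contributes \<open>p powr (A * P)\<close> and a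
  constant to the power \<open>P\<close>. The factorial costs at most another
  \<open>p powr P\<close>, whence the parameter \<open>1 + A\<close>.\<close>

lemma fact_power_exp_le_gevrey:
  fixes \<sigma> \<kappa> D :: real and p :: nat
  assumes "\<sigma> > 1" "0 < \<kappa>" "\<kappa> \<le> 1" "D \<ge> 1" "p \<ge> 1"
  defines "A \<equiv> (\<sigma> - 1) * \<kappa> powr (1 - \<sigma>)"
  shows "fact p * D ^ p * exp (p * (ln (p / \<kappa>) * (\<sigma> - 1) * (p / \<kappa>) powr (\<sigma> - 1)))
      \<le> (D * (1 / \<kappa>) powr A) powr (real p powr \<sigma> + 1) * gevrey_weight (1 + A) \<sigma> p"
proof -
  define P where "P = real p powr \<sigma>"
  have p: "real p > 0" using assms by simp
  have A: "A \<ge> 0" using assms by (simp add: A_def)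
  have pP: "real p \<le> P"
    using powr_mono[of 1 \<sigma> "real p"] assms by (simp add: P_def)
  have P: "P = p * real p powr (\<sigma> - 1)"
    using p by (simp add: P_def powr_mult_base)
  have "(p / \<kappa>) powr (\<sigma> - 1) = real p powr (\<sigma> - 1) * \<kappa> powr (1 - \<sigma>)"
    using p assms powr_minus_divide[of \<kappa> "\<sigma> - 1"] by (simp add: powr_divide)
  then have "p * (ln (p / \<kappa>) * (\<sigma> - 1) * (p / \<kappa>) powr (\<sigma> - 1)) = A * P * ln (p / \<kappa>)"
    unfolding P A_def by (simp only: mult_ac)
  also have "\<dots> = A * P * (ln p + ln (1 / \<kappa>))"
    using p assms by (simp add: ln_div)
  finally have "exp (p * (ln (p / \<kappa>) * (\<sigma> - 1) * (p / \<kappa>) powr (\<sigma> - 1)))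
      = exp (A * P * (ln p + ln (1 / \<kappa>)))"
    by (rule arg_cong)
  also have "\<dots> = real p powr (A * P) * (1 / \<kappa>) powr (A * P)"
    using p assms unfolding powr_def by (simp only: distrib_left exp_add) simp
  also have "(1 / \<kappa>) powr (A * P) = ((1 / \<kappa>) powr A) powr P"
    by (simp add: powr_powr)
  finally have E: "exp (p * (ln (p / \<kappa>) * (\<sigma> - 1) * (p / \<kappa>) powr (\<sigma> - 1)))
      = real p powr (A * P) * ((1 / \<kappa>) powr A) powr P" .
  have k: "(1 / \<kappa>) powr A \<ge> 1"
    using assms A by (intro ge_one_powr_ge_zero) auto
  have "fact p \<le> real p powr P"
  proof -
    have "fact p \<le> real p ^ p"
      using fact_le_power[of p] by simp
    also have "\<dots> = real p powr real p"
      using p by (simp add: powr_realpow)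
    also have "\<dots> \<le> real p powr P"
      using assms pP by (intro powr_mono) auto
    finally show ?thesis .
  qed
  moreover have "D ^ p \<le> D powr P"
    using powr_mono[OF pP assms(4)] assms by (simp add: powr_realpow)
  ultimately have "fact p * D ^ p * exp (p * (ln (p / \<kappa>) * (\<sigma> - 1) * (p / \<kappa>) powr (\<sigma> - 1)))
      \<le> real p powr P * D powr P * (real p powr (A * P) * ((1 / \<kappa>) powr A) powr P)"
    unfolding E using assms by (intro mult_mono) auto
  also have "\<dots> = (D * (1 / \<kappa>) powr A) powr P * real p powr ((1 + A) * P)"
  proof -
    have "(1 + A) * P = P + A * P"
      by (simp add: algebra_simps)
    moreover have "(D * (1 / \<kappa>) powr A) powr P = D powr P * ((1 / \<kappa>) powr A) powr P"
      by (rule powr_mult)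
    ultimately show ?thesis
      by (simp only: powr_add mult_ac)
  qed
  \<comment> \<open>The base is at least 1, so the exponent may grow to the \<open>P + 1\<close> of
    the class.\<close>
  also have "\<dots> \<le> (D * (1 / \<kappa>) powr A) powr (P + 1) * real p powr ((1 + A) * P)"
    using mult_mono[OF assms(4) k] assms by (intro mult_right_mono powr_mono) auto
  finally show ?thesis
    using assms by (simp add: gevrey_weight_def P_def)
qed

theorem theorem2p17:
  fixes \<sigma> :: real
  assumes "\<sigma> > 1"
  shows "lambert_flat (exp (- (1 / \<sigma>))) \<sigma> \<in> extended_gevrey \<sigma>"
proof -
  define \<rho> where "\<rho> = exp (- (1 / \<sigma>))"
  have \<rho>: "0 < \<rho>" "\<rho> \<le> 1"
    using assms by (auto simp: \<rho>_def)
  define \<kappa> where "\<kappa> = \<rho> / 2"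
  have \<kappa>: "0 < \<kappa>" "\<kappa> \<le> 1"
    using \<rho> by (auto simp: \<kappa>_def)
  \<comment> \<open>\<open>A\<close> depends on \<open>\<sigma>\<close> only: the parameter
    \<open>1 + A\<close> has to be fixed before the compact set, whereas \<open>C\<close> may depend
    on it through \<open>D\<close>.\<close>
  define A where "A = (\<sigma> - 1) * \<kappa> powr (1 - \<sigma>)"
  have A: "A \<ge> 0"
    using assms by (simp add: A_def)
  let ?f = "lambert_flat \<rho> \<sigma>"
  have "smooth_real ?f"
    unfolding smooth_real_def
  proof (intro allI)
    fix p and x :: real
    show "(deriv ^^ p) ?f field_differentiable at x"
    proof (cases "x = 0")
      case True
      then show ?thesis
        using lambert_flat_higher_deriv_0(2)[OF assms \<rho>] by simp
    next
      case False
      then have "\<bar>x\<bar> > 0" by simp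
      from lambert_flat_higher_deriv[OF assms \<rho>(1) this] show ?thesis
        using False by (metis order_refl)
    qed
  qed
  moreover have "\<exists>C>0. \<forall>p. \<forall>x\<in>K. \<bar>(deriv ^^ p) ?f x\<bar> \<le> C powr (real p powr \<sigma> + 1) * gevrey_weight (1 + A) \<sigma> p"
    if K: "compact K" for K
  proof -
    obtain R where R: "R > 0" "\<And>x. x \<in> K \<Longrightarrow> \<bar>x\<bar> \<le> R"
      using compact_imp_bounded[OF K] by (auto simp: bounded_pos)
    obtain D where D: "D \<ge> 1"
      "\<And>x p. \<lbrakk>x \<noteq> 0; \<bar>x\<bar> \<le> R\<rbrakk> \<Longrightarrow> \<bar>(deriv ^^ p) ?f x\<bar> \<le> fact p * D ^ p *
        exp (real p * ln (1 + 1 / \<bar>x\<bar>) -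
          \<kappa> * (ln (1 + 1 / \<bar>x\<bar>) * exp (1 / (\<sigma> - 1) * lambert_W (ln (1 + 1 / \<bar>x\<bar>)))))"
      using lambert_flat_higher_deriv[OF assms \<rho>(1) R(1)] unfolding \<kappa>_def by metis
    define C where "C = D * (1 / \<kappa>) powr A"
    have "(1 / \<kappa>) powr A \<ge> 1"
      using \<kappa> A by (intro ge_one_powr_ge_zero) auto
    from mult_mono[OF D(1) this] have C: "C \<ge> 1"
      using D(1) by (simp add: C_def)
    show ?thesis
    proof (intro exI[of _ C] conjI allI ballI)
      show "C > 0" using C by simp
      fix p x assume "x \<in> K"
      then have xR: "\<bar>x\<bar> \<le> R" by (rule R)
      let ?rhs = "C powr (real p powr \<sigma> + 1) * gevrey_weight (1 + A) \<sigma> p"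
      \<comment> \<open>Order 0 is separate because the maximisation needs \<open>q \<ge> 1\<close>;
        there the right-hand side is just \<open>C \<ge> 1\<close>, as
        \<open>0 powr \<sigma> = 0\<close>.\<close>
      consider "x = 0" | "x \<noteq> 0" "p = 0" | "x \<noteq> 0" "p \<ge> 1" by linarith
      then show "\<bar>(deriv ^^ p) ?f x\<bar> \<le> ?rhs"
      proof cases
        case 1
        then show ?thesis
          using lambert_flat_higher_deriv_0(1)[OF assms \<rho>] by (simp add: gevrey_weight_def)
      next
        case 2
        then have "\<kappa> * (ln (1 + 1 / \<bar>x\<bar>) * exp (1 / (\<sigma> - 1) * lambert_W (ln (1 + 1 / \<bar>x\<bar>)))) \<ge> 0"
          using \<kappa> by (intro mult_nonneg_nonneg) auto
        then show ?thesis
          using D(2)[OF 2(1) xR, of 0] C 2(2) by (simp add: gevrey_weight_def) (smt (verit) exp_le_one_iff)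
      next
        case 3
        define l where "l = ln (1 + 1 / \<bar>x\<bar>)"
        have l: "l > 0"
          unfolding l_def using 3 by (intro ln_gt_zero) simp
        \<comment> \<open>Maximisation with \<open>q = p\<close> and
          \<open>a = 1 / (\<sigma> - 1)\<close>, so that \<open>1 / a\<close> becomes the exponent
          \<open>\<sigma> - 1\<close>.\<close>
        have "real p * l - \<kappa> * (l * exp (1 / (\<sigma> - 1) * lambert_W l)) \<le>
            real p * (ln (real p / \<kappa>) / (1 / (\<sigma> - 1)) * (real p / \<kappa>) powr (1 / (1 / (\<sigma> - 1))))"
          by (rule linear_minus_lambert_le) (use l \<kappa> 3 assms in auto)
        then have "fact p * D ^ p * exp (real p * l - \<kappa> * (l * exp (1 / (\<sigma> - 1) * lambert_W l)))
          \<le> fact p * D ^ p * exp (p * (ln (p / \<kappa>) * (\<sigma> - 1) * (p / \<kappa>) powr (\<sigma> - 1)))"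
          using D(1) by (intro mult_left_mono) auto
        also have "\<dots> \<le> ?rhs"
          unfolding C_def A_def by (rule fact_power_exp_le_gevrey) (use assms \<kappa> D 3 in auto)
        finally show ?thesis
          using D(2)[OF 3(1) xR, of p] by (simp add: l_def)
      qed
    qed
  qed
  ultimately have "?f \<in> extended_gevrey2 (1 + A) \<sigma>"
    by (simp add: extended_gevrey2_def)
  then show ?thesis
    using A unfolding extended_gevrey_def \<rho>_def by force
qed

end
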